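(* Let $G$ be a graph on $n$ vertices, let $a$ be a positive real number, and let $$f(G;a)=\frac{\sum_{i=1}^n p(G;i)a^i}{\sum_{i=1}^n\sum_{k=i}^n p(G;k)\binom{k}{i}a^{k-i}}.$$ If $a+bi$ (with $b$ real) is a root of $\mathcal{P}(G;x)$, then $|b|\ge\min\left\{f(G;a),\ (f(G;a))^{1/n}\right\}$.
   Context: Graphs are finite and simple. For $S\subseteq V(G)$, $S$ is a power dominating set if, after coloring $S$, coloring every neighbor of a vertex of $S$, and then repeatedly applying the forcing rule (a colored vertex with exactly one uncolored neighbor colors that neighbor) until no changes occur, all vertices are colored. $p(G;i)$ is the number of power dominating sets of size $i$ and $\mathcal{P}(G;x)=\sum_{i=1}^n p(G;i)x^i$. *)

theory Defs
  imports
    "HOL-Analysis.Analysis"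
    "HOL-Computational_Algebra.Polynomial"
    "Graph_Theory.Pair_Digraph"
begin

text \<open>
  Finite simple graphs are the \<open>pair_graph\<close>s of the library: finite vertex set \<open>pverts G\<close> and a
  symmetric, irreflexive arc relation \<open>parcs G\<close> on it, each undirected edge being a pair of
  opposite arcs.
\<close>

definition neighbors :: "'v pair_pre_digraph \<Rightarrow> 'v \<Rightarrow> 'v set" where
  "neighbors G u = {v. (u, v) \<in> parcs G}"

definition force_step :: "'v pair_pre_digraph \<Rightarrow> 'v set \<Rightarrow> 'v set \<Rightarrow> bool" where
  "force_step G C C' \<longleftrightarrow> (\<exists>u\<in>C. \<exists>v. neighbors G u - C = {v} \<and> C' = insert v C)"

text \<open>
  By \<open>power_dominating_iff_stuck\<close> below, the forcing process started from a given set always stops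
  with the same colored set, so it does not matter in which order the forces are applied.
\<close>

definition power_dominating :: "'v pair_pre_digraph \<Rightarrow> 'v set \<Rightarrow> bool" where
  "power_dominating G S \<longleftrightarrow>
     S \<subseteq> pverts G \<and> (force_step G)\<^sup>*\<^sup>* (S \<union> (\<Union>u\<in>S. neighbors G u)) (pverts G)"

definition num_pds :: "'v pair_pre_digraph \<Rightarrow> nat \<Rightarrow> nat" where
  "num_pds G i = card {S. power_dominating G S \<and> card S = i}"

definition pd_poly :: "'v pair_pre_digraph \<Rightarrow> 'a::comm_semiring_1 poly" where
  "pd_poly G = (\<Sum>i=1..card (pverts G). monom (of_nat (num_pds G i)) i)"

definition pd_ratio :: "'v pair_pre_digraph \<Rightarrow> real \<Rightarrow> real" where
  "pd_ratio G a =
     (\<Sum>i=1..card (pverts G). real (num_pds G i) * a ^ i) /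
     (\<Sum>i=1..card (pverts G). \<Sum>k=i..card (pverts G).
        real (num_pds G k) * real (k choose i) * a ^ (k - i))"

lemma force_steps_subset_stuck:
  assumes "(force_step G)\<^sup>*\<^sup>* I D" "I \<subseteq> C" "\<nexists>C'. force_step G C C'"
  shows "D \<subseteq> C"
  using assms(1)
proof (induction rule: rtranclp_induct)
  case base
  show ?case by (fact assms(2))
next
  case (step D E)
  then obtain u v where uv: "u \<in> D" "neighbors G u - D = {v}" "E = insert v D"
    by (auto simp: force_step_def)
  have "v \<in> C"
  proof (rule ccontr)
    assume "v \<notin> C"
    then have "neighbors G u - C = {v}" using uv(2) step.IH by blast
    then have "force_step G C (insert v C)"
      using uv(1) step.IH unfolding force_step_def by blast
    then show False using assms(3) by blast
  qed
  then show ?case using uv(3) step.IH by simp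
qed

lemma force_steps_increasing: "(force_step G)\<^sup>*\<^sup>* I D \<Longrightarrow> I \<subseteq> D"
  by (induction rule: rtranclp_induct) (auto simp: force_step_def)

lemma neighbors_subset: "pair_graph G \<Longrightarrow> neighbors G u \<subseteq> pverts G"
  by (auto simp: neighbors_def pair_graph_def pair_digraph_def pair_fin_digraph_def
      dest: pair_wf_digraph.in_arcsD2)

lemma not_force_step_pverts: "pair_graph G \<Longrightarrow> \<not> force_step G (pverts G) C"
  using neighbors_subset[of G] unfolding force_step_def by blast

lemma power_dominating_iff_stuck:
  assumes G: "pair_graph G" and S: "S \<subseteq> pverts G"
    and run: "(force_step G)\<^sup>*\<^sup>* (S \<union> (\<Union>u\<in>S. neighbors G u)) C"
    and stuck: "\<nexists>C'. force_step G C C'"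
  shows "power_dominating G S \<longleftrightarrow> C = pverts G"
proof
  assume "power_dominating G S"
  then have PD: "(force_step G)\<^sup>*\<^sup>* (S \<union> (\<Union>u\<in>S. neighbors G u)) (pverts G)"
    by (simp add: power_dominating_def)
  have "pverts G \<subseteq> C"
    using force_steps_subset_stuck[OF PD force_steps_increasing[OF run] stuck] .
  moreover have "C \<subseteq> pverts G"
    using force_steps_subset_stuck[OF run force_steps_increasing[OF PD]]
      not_force_step_pverts[OF G] by blast
  ultimately show "C = pverts G" by simp
next
  assume "C = pverts G"
  then show "power_dominating G S" using S run by (simp add: power_dominating_def)
qed

end

theory Submission
  imports Defs
begin

text \<open>
  Expanding \<open>\<P>(G; a + bi)\<close> in powers of \<open>bi\<close>, the constant term is the numerator of \<open>f(G; a)\<close> and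
  the other coefficients, which are nonnegative because the \<open>p(G; k)\<close> are, add up to its
  denominator. At a root the constant term is cancelled by the others, each of which carries a
  factor of modulus \<open>|b|\<^sup>i \<le> max {|b|, |b|\<^sup>n}\<close>. Hence \<open>f(G; a) \<le> max {|b|, |b|\<^sup>n}\<close>.
\<close>

lemma power_le_max_power:
  fixes x :: "'a::linordered_semidom"
  assumes "0 \<le> x" "1 \<le> i" "i \<le> n"
  shows "x ^ i \<le> max x (x ^ n)"
proof (cases "x \<le> 1")
  case True
  then have "x ^ i \<le> x ^ 1" using assms by (intro power_decreasing) auto
  then show ?thesis by (simp add: le_max_iff_disj)
next
  case False
  then have "x ^ i \<le> x ^ n" using assms by (intro power_increasing) auto
  then show ?thesis by (simp add: le_max_iff_disj)
qed

lemma min_powr_inverse_le: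
  fixes x y :: real
  assumes "0 \<le> x" "0 < n" "y \<le> max x (x ^ n)"
  shows "min y (y powr (1 / real n)) \<le> x"
proof (cases "y \<le> x")
  case True
  then show ?thesis by simp
next
  case False
  then have "y powr (1 / real n) = root n y" using assms by (simp add: root_powr_inverse)
  also have "\<dots> \<le> root n (x ^ n)" using False assms by (simp add: le_max_iff_disj)
  also have "\<dots> = x" using assms by (simp add: real_root_power_cancel)
  finally show ?thesis by simp
qed

lemma poly_eq_sum_coeff:
  fixes x :: "'a::comm_semiring_1"
  assumes "degree p \<le> n"
  shows "poly p x = (\<Sum>i\<le>n. coeff p i * x ^ i)"
  by (subst poly_as_sum_of_monoms'[OF assms, symmetric]) (simp add: poly_sum poly_monom)

lemma coeff_pcompose_shift:
  fixes a :: "'a::comm_semiring_1"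
  assumes "degree p \<le> n"
  shows "coeff (p \<circ>\<^sub>p [:a, 1:]) i = (\<Sum>k=i..n. coeff p k * of_nat (k choose i) * a ^ (k - i))"
proof -
  have "p \<circ>\<^sub>p [:a, 1:] = (\<Sum>k\<le>n. monom (coeff p k) k) \<circ>\<^sub>p [:a, 1:]"
    by (simp add: poly_as_sum_of_monoms'[OF assms])
  also have "\<dots> = (\<Sum>k\<le>n. smult (coeff p k) ([:a, 1:] ^ k))"
    unfolding pcompose_sum by (simp add: pcompose_altdef map_poly_monom poly_monom)
  finally have "coeff (p \<circ>\<^sub>p [:a, 1:]) i = (\<Sum>k\<le>n. coeff p k * coeff ([:a, 1:] ^ k) i)"
    by (simp add: coeff_sum)
  also have "\<dots> = (\<Sum>k=i..n. coeff p k * coeff ([:a, 1:] ^ k) i)"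
  proof (rule sum.mono_neutral_right)
    have "coeff ([:a, 1:] ^ k) i = 0" if "k < i" for k
      using degree_power_le[of "[:a, 1:]" k] that by (intro coeff_eq_0) simp
    then show "\<forall>k\<in>{..n} - {i..n}. coeff p k * coeff ([:a, 1:] ^ k) i = 0"
      by auto
  qed auto
  also have "\<dots> = (\<Sum>k=i..n. coeff p k * of_nat (k choose i) * a ^ (k - i))"
    by (simp add: coeff_linear_poly_power mult.assoc)
  finally show ?thesis .
qed

lemma map_poly_of_real_pcompose_shift:
  "map_poly of_real (p \<circ>\<^sub>p [:a, 1:]) =
    map_poly of_real p \<circ>\<^sub>p [:of_real a :: 'a::{real_algebra_1,comm_ring_1}, 1:]"
proof (rule poly_eqI)
  fix i
  show "coeff (map_poly of_real (p \<circ>\<^sub>p [:a, 1:])) i =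
      coeff (map_poly of_real p \<circ>\<^sub>p [:of_real a :: 'a, 1:]) i"
    by (simp add: coeff_map_poly coeff_pcompose_shift[of _ "degree p"] degree_map_poly)
qed

lemma norm_coeff_0_le_at_root:
  fixes p :: "'a::real_normed_field poly"
  assumes "degree p \<le> n" and root: "poly p x = 0"
  shows "norm (coeff p 0) \<le> max (norm x) (norm x ^ n) * (\<Sum>i=1..n. norm (coeff p i))"
proof -
  have "coeff p 0 + (\<Sum>i=1..n. coeff p i * x ^ i) = poly p x"
    by (simp add: poly_eq_sum_coeff[OF assms(1)] atMost_atLeast0 sum.atLeast_Suc_atMost)
  then have "norm (coeff p 0) = norm (\<Sum>i=1..n. coeff p i * x ^ i)"
    using root by (simp add: add_eq_0_iff2)
  also have "\<dots> \<le> (\<Sum>i=1..n. max (norm x) (norm x ^ n) * norm (coeff p i))"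
  proof (rule sum_norm_le)
    fix i assume "i \<in> {1..n}"
    then have "norm x ^ i \<le> max (norm x) (norm x ^ n)"
      by (intro power_le_max_power) auto
    then show "norm (coeff p i * x ^ i) \<le> max (norm x) (norm x ^ n) * norm (coeff p i)"
      by (subst mult.commute) (simp add: norm_mult norm_power mult_right_mono)
  qed
  finally show ?thesis by (simp add: sum_distrib_left)
qed

lemma poly_div_sum_coeff_shift_le_at_root:
  fixes p :: "real poly" and h :: "'a::real_normed_field"
  assumes deg: "degree p \<le> n" and nonneg: "\<And>k. 0 \<le> coeff p k" and "0 \<le> a"
    and root: "poly (map_poly of_real p) (of_real a + h) = 0"
  shows "poly p a / (\<Sum>i=1..n. coeff (p \<circ>\<^sub>p [:a, 1:]) i) \<le> max (norm h) (norm h ^ n)"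
proof -
  define q where "q = p \<circ>\<^sub>p [:a, 1:]"
  have q_nonneg: "0 \<le> coeff q i" for i
    using nonneg \<open>0 \<le> a\<close> by (simp add: q_def coeff_pcompose_shift[OF deg] sum_nonneg)
  have "degree q \<le> n"
    using deg degree_pcompose[of p "[:a, 1:]"] by (simp add: q_def)
  moreover have "poly (map_poly of_real q) h = 0"
    using root by (simp add: q_def map_poly_of_real_pcompose_shift poly_pcompose)
  ultimately have "coeff q 0 \<le> max (norm h) (norm h ^ n) * (\<Sum>i=1..n. coeff q i)"
    using norm_coeff_0_le_at_root[of "map_poly of_real q" n h] q_nonneg
    by (simp add: degree_map_poly coeff_map_poly)
  moreover have "0 \<le> (\<Sum>i=1..n. coeff q i)"
    using q_nonneg by (simp add: sum_nonneg)
  ultimately have "coeff q 0 / (\<Sum>i=1..n. coeff q i) \<le> max (norm h) (norm h ^ n)"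
    by (cases "(\<Sum>i=1..n. coeff q i) = 0") (auto simp: le_max_iff_disj pos_divide_le_eq)
  then show ?thesis by (simp add: q_def)
qed

lemma coeff_pd_poly:
  "coeff (pd_poly G) k = (if k \<in> {1..card (pverts G)} then of_nat (num_pds G k) else 0)"
  by (simp add: pd_poly_def coeff_sum)

lemma degree_pd_poly_le: "degree (pd_poly G) \<le> card (pverts G)"
  by (rule degree_le) (simp add: coeff_pd_poly)

lemma map_poly_of_real_pd_poly:
  "map_poly of_real (pd_poly G) = (pd_poly G :: 'a::{real_algebra_1,comm_ring_1} poly)"
  by (rule poly_eqI) (simp add: coeff_map_poly coeff_pd_poly)

lemma pd_ratio_eq_poly_div_sum_coeff_shift:
  "pd_ratio G a =
    poly (pd_poly G) a / (\<Sum>i=1..card (pverts G). coeff (pd_poly G \<circ>\<^sub>p [:a, 1:]) i)"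
proof -
  have "poly (pd_poly G) a = (\<Sum>i=1..card (pverts G). real (num_pds G i) * a ^ i)"
    by (simp add: pd_poly_def poly_sum poly_monom)
  moreover have "coeff (pd_poly G \<circ>\<^sub>p [:a, 1:]) i =
      (\<Sum>k=i..card (pverts G). real (num_pds G k) * real (k choose i) * a ^ (k - i))"
    if "1 \<le> i" for i
    unfolding coeff_pcompose_shift[OF degree_pd_poly_le]
    using that by (intro sum.cong) (auto simp: coeff_pd_poly)
  ultimately show ?thesis by (simp add: pd_ratio_def)
qed

theorem theorem36:
  fixes G :: "'v pair_pre_digraph" and n :: nat and a b :: real
  assumes "pair_graph G" and "card (pverts G) = n"
    and "a > 0"
    and "poly (pd_poly G) (Complex a b) = 0"
  shows "\<bar>b\<bar> \<ge> min (pd_ratio G a) (pd_ratio G a powr (1 / real n))"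
proof (cases "n = 0")
  case True
  then have "pd_ratio G a = 0" using assms(2) by (simp add: pd_ratio_def)
  then show ?thesis by simp
next
  case False
  have "poly (map_poly of_real (pd_poly G)) (of_real a + \<i> * of_real b) = 0"
    using assms(4) by (simp add: map_poly_of_real_pd_poly Complex_eq)
  then have "pd_ratio G a \<le> max (norm (\<i> * of_real b)) (norm (\<i> * of_real b) ^ n)"
    using assms(2,3) degree_pd_poly_le[of G]
    unfolding pd_ratio_eq_poly_div_sum_coeff_shift assms(2)
    by (intro poly_div_sum_coeff_shift_le_at_root) (auto simp: coeff_pd_poly)
  then show ?thesis
    using False by (intro min_powr_inverse_le) (auto simp: norm_mult)
qed

end
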